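(* Let $n\geq 2$ and let $k$ be an integer with $0<k<n$ and $\gcd(n,k)=1$. Then the number of permutations in $\{D_n^k\}$ is the same as the number of permutations in $\{D_n\}$; that is, $D_n^k=D_n$.
   Context: $[n]=\{1,2,\ldots,n\}$; permutations of $[n]$ are written in one-line notation $a_1a_2\cdots a_n$, and a permutation avoids the substring $ab$ if there is no index $i$, $1\leq i\leq n-1$, with $a_i=a$ and $a_{i+1}=b$. $\{D_n\}$ is the set of permutations of $[n]$ that avoid all the substrings $12,23,\ldots,(n-1)n,n1$, and $D_n$ is the number of such permutations. For $0<k<n$, $\{D_n^k\}$ is the set of permutations of $[n]$ that avoid all the substrings $j(j+k)\ (\mathrm{mod}\ n)$, $1\leq j\leq n$, where residues mod $n$ are represented by elements of $[n]$ (writing $n$ instead of $0$), and $D_n^k$ is the number of such permutations. The superscript $k$ is an index, not an exponent. *)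

theory Defs
  imports Main "HOL-Combinatorics.Multiset_Permutations"
begin

text \<open>
  A permutation of \<open>{1..n}\<close> in one-line notation \<open>a\<^sub>1a\<^sub>2\<cdots>a\<^sub>n\<close> is a list in
  \<^term>\<open>permutations_of_set {1..n::nat}\<close>. List positions start at 0, so the entry
  \<open>a\<^sub>i\<close> is \<open>xs ! (i - 1)\<close>.
\<close>

definition avoids_substring :: "nat list \<Rightarrow> nat \<Rightarrow> nat \<Rightarrow> bool" where
  "avoids_substring xs a b \<longleftrightarrow> \<not> (\<exists>i. Suc i < length xs \<and> xs ! i = a \<and> xs ! Suc i = b)"

text \<open>The representative in \<open>{1..n}\<close>, rather than \<open>{0..<n}\<close>, of \<open>m\<close> modulo \<open>n\<close>.\<close>

definition residue_rep :: "nat \<Rightarrow> nat \<Rightarrow> nat" where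
  "residue_rep n m = (if m mod n = 0 then n else m mod n)"

definition D_set :: "nat \<Rightarrow> nat list set" where
  "D_set n = {xs \<in> permutations_of_set {1..n}.
     (\<forall>j. 1 \<le> j \<and> j < n \<longrightarrow> avoids_substring xs j (j + 1)) \<and> avoids_substring xs n 1}"

definition D :: "nat \<Rightarrow> nat" where
  "D n = card (D_set n)"

text \<open>
  In \<open>Dk_set n k\<close> and \<open>Dk n k\<close> the argument \<open>k\<close> is the superscript index of \<open>D\<^sub>n\<^sup>k\<close>; these
  notions are intended for \<open>0 < k < n\<close>.
\<close>

definition Dk_set :: "nat \<Rightarrow> nat \<Rightarrow> nat list set" where
  "Dk_set n k = {xs \<in> permutations_of_set {1..n}.
     \<forall>j\<in>{1..n}. avoids_substring xs j (residue_rep n (j + k))}"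

definition Dk :: "nat \<Rightarrow> nat \<Rightarrow> nat" where
  "Dk n k = card (Dk_set n k)"

end

theory Submission
  imports Defs "HOL-Number_Theory.Cong"
begin

text \<open>
  Both conditions forbid the steps of a cyclic walk on the residues modulo \<open>n\<close>: by \<open>1\<close> for
  \<^const>\<open>D_set\<close>, by \<open>k\<close> for \<^const>\<open>Dk_set\<close>. Since \<open>k\<close> is a unit modulo \<open>n\<close>, multiplication
  by \<open>k\<close> permutes the residues, and it carries each step \<open>j, j + 1\<close> to a step
  \<open>k j, k j + k\<close>, every step by \<open>k\<close> arising exactly once. Relabelling the entries of a
  permutation in this way therefore turns the first avoidance condition into the second, and it
  is a bijection on the permutations of \<open>{1..n}\<close>.
\<close>

lemma residue_rep_in_range: "n > 0 \<Longrightarrow> residue_rep n m \<in> {1..n}"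
  by (auto simp: residue_rep_def Suc_le_eq less_imp_le)

lemma cong_residue_rep: "[residue_rep n m = m] (mod n)"
  by (simp add: residue_rep_def cong_def)

lemma residue_rep_cong: "[a = b] (mod n) \<Longrightarrow> residue_rep n a = residue_rep n b"
  by (simp add: residue_rep_def cong_def)

lemma residue_rep_id: "x \<in> {1..n} \<Longrightarrow> residue_rep n x = x"
  by (cases "x = n") (auto simp: residue_rep_def)

lemma bij_betw_residue_rep_mult:
  assumes "n > 0" and "coprime k n"
  shows "bij_betw (\<lambda>x. residue_rep n (k * x)) {1..n} {1..n}"
proof -
  let ?f = "\<lambda>x. residue_rep n (k * x)"
  have "inj_on ?f {1..n}"
  proof (rule inj_onI)
    fix x y assume xy: "x \<in> {1..n}" "y \<in> {1..n}" and eq: "?f x = ?f y"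
    have "[k * x = k * y] (mod n)"
      using eq cong_residue_rep by (metis cong_sym cong_trans)
    then have "[x = y] (mod n)"
      using assms(2) by (simp add: cong_mult_lcancel_nat)
    then show "x = y"
      using xy residue_rep_cong residue_rep_id by metis
  qed
  moreover have "?f ` {1..n} \<subseteq> {1..n}"
    using residue_rep_in_range[OF assms(1)] by blast
  ultimately show ?thesis
    by (simp add: bij_betw_def endo_inj_surj)
qed

lemma residue_rep_mult_add:
  "residue_rep n (k * residue_rep n (j + 1)) = residue_rep n (residue_rep n (k * j) + k)"
proof (rule residue_rep_cong)
  have "[k * residue_rep n (j + 1) = k * (j + 1)] (mod n)"
    by (intro cong_mult cong_refl cong_residue_rep)
  moreover have "[residue_rep n (k * j) + k = k * j + k] (mod n)"
    by (intro cong_add cong_refl cong_residue_rep)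
  ultimately show "[k * residue_rep n (j + 1) = residue_rep n (k * j) + k] (mod n)"
    by (metis cong_sym cong_trans distrib_left mult.right_neutral)
qed

lemma avoids_substring_map:
  assumes "inj_on f A" and "set xs \<subseteq> A" and "a \<in> A" and "b \<in> A"
  shows "avoids_substring (map f xs) (f a) (f b) \<longleftrightarrow> avoids_substring xs a b"
proof -
  have "f (xs ! i) = f c \<longleftrightarrow> xs ! i = c" if "i < length xs" "c \<in> A" for i c
    using assms(1,2) that by (meson inj_on_eq_iff nth_mem subsetD)
  then show ?thesis
    using assms(3,4) unfolding avoids_substring_def by (metis Suc_lessD length_map nth_map)
qed

text \<open>
  The separate condition on \<open>n, 1\<close> in \<^const>\<open>D_set\<close> is the step \<open>j = n\<close> of the cyclic walk,
  where \<open>n + 1\<close> is represented by \<open>1\<close>.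
\<close>

lemma D_set_eq_Dk_set_1:
  assumes "n > 0"
  shows "D_set n = Dk_set n 1"
proof -
  have succ: "residue_rep n (j + 1) = j + 1" if "1 \<le> j" "j < n" for j
    using that by (intro residue_rep_id) auto
  have wrap: "residue_rep n (n + 1) = 1"
  proof -
    have "[n + 1 = 1] (mod n)"
      unfolding cong_def by (rule mod_add_self1)
    then show ?thesis
      using assms residue_rep_cong residue_rep_id[of 1 n] by fastforce
  qed
  have "(\<forall>j\<in>{1..n}. avoids_substring xs j (residue_rep n (j + 1))) \<longleftrightarrow>
      (\<forall>j. 1 \<le> j \<and> j < n \<longrightarrow> avoids_substring xs j (j + 1)) \<and> avoids_substring xs n 1" for xs
    using assms succ wrap
    by (metis One_nat_def Suc_leI atLeastAtMost_iff le_neq_implies_less less_imp_le order_refl)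
  then show ?thesis
    unfolding D_set_def Dk_set_def by simp
qed

lemma Dk_set_eq_image_Dk_set_1:
  assumes "n > 0" and "coprime k n"
  defines "f \<equiv> \<lambda>x. residue_rep n (k * x)"
  shows "Dk_set n k = map f ` Dk_set n 1"
proof -
  have inj: "inj_on f {1..n}" and im: "f ` {1..n} = {1..n}"
    using bij_betw_residue_rep_mult[OF assms(1,2)] by (simp_all add: bij_betw_def f_def)
  have perms: "permutations_of_set {1..n} = map f ` permutations_of_set {1..n}"
    using permutations_of_set_image_inj[OF inj] unfolding im .
  have iff: "(\<forall>j\<in>{1..n}. avoids_substring (map f xs) j (residue_rep n (j + k))) \<longleftrightarrow>
      (\<forall>j\<in>{1..n}. avoids_substring xs j (residue_rep n (j + 1)))"
    if "xs \<in> permutations_of_set {1..n}" for xs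
  proof -
    have xs: "set xs \<subseteq> {1..n}"
      using that by (simp add: permutations_of_set_def)
    \<comment> \<open>Every starting point of a step by \<open>k\<close> is \<open>f i\<close> for a unique \<open>i\<close>, so the steps can be
      reindexed by \<open>i\<close>.\<close>
    have "(\<forall>j\<in>{1..n}. avoids_substring (map f xs) j (residue_rep n (j + k))) \<longleftrightarrow>
        (\<forall>i\<in>{1..n}. avoids_substring (map f xs) (f i) (residue_rep n (f i + k)))"
      using im by (metis (no_types, lifting) image_iff)
    also have "\<dots> \<longleftrightarrow>
        (\<forall>i\<in>{1..n}. avoids_substring (map f xs) (f i) (f (residue_rep n (i + 1))))"
      unfolding f_def residue_rep_mult_add ..
    also have "\<dots> \<longleftrightarrow> (\<forall>i\<in>{1..n}. avoids_substring xs i (residue_rep n (i + 1)))"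
      using avoids_substring_map[OF inj xs] residue_rep_in_range[OF assms(1)] by blast
    finally show ?thesis .
  qed
  show ?thesis
    unfolding Dk_set_def by (subst perms) (use iff in auto)
qed

theorem proposition2p5:
  fixes n k :: nat
  assumes "n \<ge> 2" and "0 < k" and "k < n" and "gcd n k = 1"
  shows "Dk n k = D n"
proof -
  define f where "f = (\<lambda>x. residue_rep n (k * x))"
  have n: "n > 0" and cop: "coprime k n"
    using assms(1,4) by (auto simp: coprime_iff_gcd_eq_1 gcd.commute)
  have "inj_on f {1..n}"
    using bij_betw_residue_rep_mult[OF n cop] by (simp add: bij_betw_def f_def)
  then have "inj_on (map f) (Dk_set n 1)"
    by (intro inj_on_mapI) (auto simp: Dk_set_def permutations_of_set_def intro: inj_on_subset)
  then have "card (map f ` Dk_set n 1) = card (Dk_set n 1)"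
    by (rule card_image)
  then show ?thesis
    unfolding Dk_def D_def D_set_eq_Dk_set_1[OF n] Dk_set_eq_image_Dk_set_1[OF n cop] f_def .
qed

end
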